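(* Let $K\ge1$ and $Q\ge 1$ be integers, and let $\eta,B,L,\sigma^2>0$ and $P_k,\kappa_k>0$ for $k=1,\dots,K$. The optimization problem $$\mathop{\text{minimize}}_{\lambda_1,\dots,\lambda_K}\quad\frac1K\sum_{k=1}^K48\,\frac{1-\lambda_k^2}{\lambda_k^2}\,\eta^2B^2Q^2L^2+\frac{8\eta L\sigma^2}{K^2}\max_{k\in\{1,\dots,K\}}\frac{\lambda_kB^2Q\left(\frac{4(1-\lambda_k^2)}{\lambda_k^2}+1\right)}{P_k\kappa_k\ln(1/\lambda_k)}$$ $$\text{subject to}\quad 0<\lambda_k<1,\quad k=1,\dots,K,$$ is convex; that is, its objective is a convex function of $(\lambda_1,\dots,\lambda_K)$ on the convex set $(0,1)^K$.
   Context: A minimization problem is called convex if its objective is a convex function and its feasible set is convex. $\ln$ is the natural logarithm. *)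

theory Defs
  imports "HOL-Analysis.Analysis"
begin

definition convex_minimization :: "('a::real_vector \<Rightarrow> real) \<Rightarrow> 'a set \<Rightarrow> bool" where
  "convex_minimization f S \<longleftrightarrow> convex S \<and> convex_on S f"

text \<open>The number \<open>K\<close> of variables is the cardinality of the finite index type \<open>'k\<close>; finite types
  are nonempty, so \<open>K \<ge> 1\<close> holds automatically. The parameter \<open>s\<close> is the variance \<open>\<sigma>\<^sup>2\<close>.\<close>

definition objective ::
  "nat \<Rightarrow> real \<Rightarrow> real \<Rightarrow> real \<Rightarrow> real \<Rightarrow> real ^ 'k \<Rightarrow> real ^ 'k \<Rightarrow> real ^ 'k \<Rightarrow> real" where
  "objective Q \<eta> B L s P \<kappa> lam =
     1 / real CARD('k) *
       (\<Sum>k\<in>UNIV. 48 * ((1 - (lam $ k)^2) / (lam $ k)^2) * \<eta>^2 * B^2 * (real Q)^2 * L^2)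
     + 8 * \<eta> * L * s / (real CARD('k))^2 *
       (MAX k\<in>UNIV. lam $ k * B^2 * real Q * (4 * (1 - (lam $ k)^2) / (lam $ k)^2 + 1)
                      / (P $ k * \<kappa> $ k * ln (1 / lam $ k)))"

definition feasible_set :: "(real ^ 'k) set" where
  "feasible_set = {lam. \<forall>k. 0 < lam $ k \<and> lam $ k < 1}"

end

(* Up to positive factors, each entry of the maximum is h(x) = (4/x - 3x) / ln(1/x).  With
   l = ln(1/x), x^3 l^3 h''(x) = 8 l^2 - 12 l + 8 - exp(-2l) (3l + 6), which is positive by
   exp(2l) >= 1 + 2l + 2l^2.  Sums and finite maxima preserve convexity. *)
theory Submission
  imports Defs
begin

lemma convex_feasible_set: "convex (feasible_set :: (real ^ 'k) set)"
proof -
  have "feasible_set = (\<Inter>k. (\<lambda>lam :: real ^ 'k. lam $ k) -` {0<..<1})"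
    unfolding feasible_set_def by auto
  moreover have "convex ((\<lambda>lam :: real ^ 'k. lam $ k) -` {0<..<1})" for k
    by (intro convex_linear_vimage bounded_linear.linear[OF bounded_linear_vec_nth]) auto
  ultimately show ?thesis
    by (metis (no_types, lifting) convex_INT)
qed

text \<open>Coordinate projection is linear and maps \<open>feasible_set\<close> into the open unit
  interval, so Jensen's inequality for \<open>f\<close> transfers directly. This reduces both parts
  of the objective to functions of one variable.\<close>

lemma convex_on_coordinate:
  fixes f :: "real \<Rightarrow> real"
  assumes "convex_on {0<..<1} f"
  shows "convex_on (feasible_set :: (real ^ 'k) set) (\<lambda>lam. f (lam $ k))"
  unfolding convex_on_def
proof (intro conjI ballI allI impI convex_feasible_set)
  fix x y :: "real ^ 'k" and u v :: real
  assume "x \<in> feasible_set" "y \<in> feasible_set" "0 \<le> u" "0 \<le> v" "u + v = 1"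
  then show "f ((u *\<^sub>R x + v *\<^sub>R y) $ k) \<le> u * f (x $ k) + v * f (y $ k)"
    using assms unfolding convex_on_def feasible_set_def by simp
qed

text \<open>Convexity on \<open>S\<close> includes convexity of \<open>S\<close> itself, so every
  convex combination at which the functions are compared lies in \<open>S\<close> again.\<close>

lemma convex_on_cong_on:
  assumes "\<And>x. x \<in> S \<Longrightarrow> f x = g x"
  shows "convex_on S f \<longleftrightarrow> convex_on S g"
  using assms by (auto simp: convex_on_def convex_def)

lemma convex_on_sum_of_functions:
  fixes f :: "'i \<Rightarrow> 'a::real_vector \<Rightarrow> real"
  assumes "finite I" "convex S" and "\<And>i. i \<in> I \<Longrightarrow> convex_on S (f i)"
  shows "convex_on S (\<lambda>x. \<Sum>i\<in>I. f i x)"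
  using assms(1,3)
  \<comment> \<open>\<open>convex S\<close> settles the empty sum, where the function is constant
    and only the domain matters.\<close>
  by (induction I rule: finite_induct) (auto simp: convex_on_const \<open>convex S\<close>)

text \<open>Each \<open>f i\<close> at a convex combination is bounded by the same combination of
  the two maxima, a bound that does not depend on \<open>i\<close>; hence it also bounds the maximum
  over \<open>i\<close>.\<close>

lemma convex_on_Max:
  fixes f :: "'i \<Rightarrow> 'a::real_vector \<Rightarrow> real"
  assumes "finite I" "I \<noteq> {}" and f: "\<And>i. i \<in> I \<Longrightarrow> convex_on S (f i)"
  shows "convex_on S (\<lambda>x. MAX i\<in>I. f i x)"
  unfolding convex_on_def
proof (intro conjI ballI allI impI)
  show "convex S"
    using assms convex_on_imp_convex by blast
next
  fix x y :: 'a and u v :: real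
  assume xy: "x \<in> S" "y \<in> S" and uv: "0 \<le> u" "0 \<le> v" "u + v = 1"
  have "f i (u *\<^sub>R x + v *\<^sub>R y) \<le> u * (MAX i\<in>I. f i x) + v * (MAX i\<in>I. f i y)"
    if "i \<in> I" for i
  proof -
    have "f i (u *\<^sub>R x + v *\<^sub>R y) \<le> u * f i x + v * f i y"
      using f[OF that] xy uv unfolding convex_on_def by blast
    also have "\<dots> \<le> u * (MAX i\<in>I. f i x) + v * (MAX i\<in>I. f i y)"
      using that assms(1) uv by (intro add_mono mult_left_mono Max_ge) auto
    finally show ?thesis .
  qed
  then show "(MAX i\<in>I. f i (u *\<^sub>R x + v *\<^sub>R y)) \<le> u * (MAX i\<in>I. f i x) + v * (MAX i\<in>I. f i y)"
    using assms(1,2) by (subst Max_le_iff) auto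
qed

text \<open>The function is 1/x^2 - 1, whose second derivative 6/x^4 is nonnegative.\<close>

lemma convex_on_ratio_squares:
  "convex_on {0<..<1} (\<lambda>x::real. (1 - x\<^sup>2) / x\<^sup>2)"
proof (rule f''_ge0_imp_convex)
  fix x :: real
  assume "x \<in> {0<..<1}"
  then have x: "x \<noteq> 0" "0 < x" by auto
  show "((\<lambda>x. (1 - x\<^sup>2) / x\<^sup>2) has_real_derivative - 2 / x ^ 3) (at x)"
    using x by (auto intro!: derivative_eq_intros simp: field_simps eval_nat_numeral)
  show "((\<lambda>x. - 2 / x ^ 3) has_real_derivative 6 / x ^ 4) (at x)"
    using x by (auto intro!: derivative_eq_intros simp: field_simps eval_nat_numeral)
  show "0 \<le> 6 / x ^ 4" by simp
qed auto

text \<open>Replacing \<open>exp (- 2 * l)\<close> by the larger 1/E, with E the quadratic Taylor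
  polynomial of \<open>exp (2 * l)\<close>, and multiplying by E leaves a polynomial inequality in
  \<open>l\<close>.\<close>

lemma second_derivative_numerator_pos:
  fixes l :: real
  assumes "0 < l"
  shows "0 < 8 * l\<^sup>2 - 12 * l + 8 - exp (- 2 * l) * (3 * l + 6)"
proof -
  define E where "E = 1 + 2 * l + 2 * l\<^sup>2"
  have E: "0 < E" "E \<le> exp (2 * l)"
    using assms exp_lower_Taylor_quadratic[of "2 * l"]
    by (auto simp: E_def power2_eq_square intro: add_pos_nonneg)
  \<comment> \<open>This is the polynomial left after multiplying by E; its quadratic terms
    cancel.\<close>
  have "0 < 2 + l - 8 * l ^ 3 + 16 * l ^ 4"
  \<comment> \<open>The last two terms are 8 l^3 (2 l - 1), which changes sign at 1/2. Below that
    point 8 l^3 is at most 1, so the constant 2 dominates it.\<close>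
  proof (cases "l \<le> 1 / 2")
    case True
    then have "l ^ 3 \<le> (1 / 2) ^ 3"
      using assms by (intro power_mono) auto
    then have "8 * l ^ 3 \<le> 1" by (simp add: power_divide)
    then show ?thesis
      using assms zero_le_power[of l 4] by linarith
  next
    case False
    then have "0 \<le> 8 * l ^ 3 * (2 * l - 1)"
      using assms by simp
    then have "8 * l ^ 3 \<le> 16 * l ^ 4"
      by (simp add: algebra_simps eval_nat_numeral)
    then show ?thesis using assms by linarith
  qed
  also have "\<dots> = (8 * l\<^sup>2 - 12 * l + 8) * E - (3 * l + 6)"
    by (simp add: E_def algebra_simps eval_nat_numeral)
  finally have "(3 * l + 6) / E < 8 * l\<^sup>2 - 12 * l + 8"
    using E(1) by (simp add: field_simps)
  moreover have "exp (- 2 * l) * (3 * l + 6) \<le> (3 * l + 6) / E"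
  proof -
    have "exp (- 2 * l) = 1 / exp (2 * l)" by (simp add: exp_minus field_simps)
    also have "\<dots> \<le> 1 / E" using E by (intro divide_left_mono) auto
    finally have "exp (- 2 * l) * (3 * l + 6) \<le> 1 / E * (3 * l + 6)"
      using assms by (intro mult_right_mono) auto
    then show ?thesis by simp
  qed
  ultimately show ?thesis by linarith
qed

lemma convex_on_log_quotient:
  "convex_on {0<..<1} (\<lambda>x::real. (4 / x - 3 * x) / ln (1 / x))"
proof (rule f''_ge0_imp_convex)
  fix x :: real
  assume "x \<in> {0<..<1}"
  then have x: "0 < x" "x < 1" "x \<noteq> 0" by auto
  define l where "l = ln (1 / x)"
  have l: "0 < l" "l \<noteq> 0" using x by (auto simp: l_def)
  have dl: "((\<lambda>x. ln (1 / x)) has_real_derivative - 1 / x) (at x)"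
    using x by (auto intro!: derivative_eq_intros simp: field_simps)
  show "((\<lambda>x. (4 / x - 3 * x) / ln (1 / x)) has_real_derivative
      (- 4 / x\<^sup>2 - 3) / ln (1 / x) + (4 / x\<^sup>2 - 3) / (ln (1 / x))\<^sup>2) (at x)"
    using x l unfolding l_def
    by (auto intro!: derivative_eq_intros dl simp: field_simps eval_nat_numeral)
  \<comment> \<open>The derivative is first kept in the raw form produced by the quotient rule on
    each summand, and only then brought over the common denominator x^3 l^3.\<close>
  have "((\<lambda>x. (- 4 / x\<^sup>2 - 3) / ln (1 / x) + (4 / x\<^sup>2 - 3) / (ln (1 / x))\<^sup>2)
      has_real_derivative
        (8 / x ^ 3 * l - (- 4 / x\<^sup>2 - 3) * (- 1 / x)) / (l * l)
        + (- 8 / x ^ 3 * l\<^sup>2 - (4 / x\<^sup>2 - 3) * (2 * l * (- 1 / x))) / (l\<^sup>2 * l\<^sup>2)) (at x)"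
    unfolding l_def
  proof (intro DERIV_add DERIV_divide dl)
    show "((\<lambda>x. - 4 / x\<^sup>2 - 3) has_real_derivative 8 / x ^ 3) (at x)"
      using x by (auto intro!: derivative_eq_intros simp: field_simps eval_nat_numeral)
    show "((\<lambda>x. 4 / x\<^sup>2 - 3) has_real_derivative - 8 / x ^ 3) (at x)"
      using x by (auto intro!: derivative_eq_intros simp: field_simps eval_nat_numeral)
    show "((\<lambda>x. (ln (1 / x))\<^sup>2) has_real_derivative 2 * ln (1 / x) * (- 1 / x)) (at x)"
      using DERIV_power[OF dl, of 2] by simp
  qed (use l in \<open>simp_all add: l_def\<close>)
  also have "(8 / x ^ 3 * l - (- 4 / x\<^sup>2 - 3) * (- 1 / x)) / (l * l)
        + (- 8 / x ^ 3 * l\<^sup>2 - (4 / x\<^sup>2 - 3) * (2 * l * (- 1 / x))) / (l\<^sup>2 * l\<^sup>2)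
      = (8 * l\<^sup>2 - 12 * l + 8 - x\<^sup>2 * (3 * l + 6)) / (x ^ 3 * l ^ 3)"
    using x l by (simp add: field_simps eval_nat_numeral)
  finally show "((\<lambda>x. (- 4 / x\<^sup>2 - 3) / ln (1 / x) + (4 / x\<^sup>2 - 3) / (ln (1 / x))\<^sup>2)
      has_real_derivative (8 * (ln (1 / x))\<^sup>2 - 12 * ln (1 / x) + 8 - x\<^sup>2 * (3 * ln (1 / x) + 6))
        / (x ^ 3 * (ln (1 / x)) ^ 3)) (at x)"
    unfolding l_def .
  \<comment> \<open>Since x = exp(-l), the numerator becomes a function of \<open>l\<close> alone,
    namely the one already shown positive; the denominator is positive because \<open>x\<close> and
    \<open>l\<close> are.\<close>
  have "x\<^sup>2 = exp (- 2 * l)"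
    using x by (simp add: l_def ln_div exp_double)
  then show "0 \<le> (8 * (ln (1 / x))\<^sup>2 - 12 * ln (1 / x) + 8 - x\<^sup>2 * (3 * ln (1 / x) + 6))
        / (x ^ 3 * (ln (1 / x)) ^ 3)"
    using second_derivative_numerator_pos[OF l(1)] x l unfolding l_def
    by (intro divide_nonneg_nonneg) auto
qed auto

theorem propositionV1:
  fixes Q :: nat and \<eta> B L \<sigma> :: real and P \<kappa> :: "real ^ 'k"
  assumes "Q \<ge> 1"
    and "\<eta> > 0" and "B > 0" and "L > 0" and "\<sigma>\<^sup>2 > 0"
    and "\<And>k. P $ k > 0" and "\<And>k. \<kappa> $ k > 0"
  shows "convex_minimization (objective Q \<eta> B L (\<sigma>\<^sup>2) P \<kappa>) feasible_set"
proof -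
  have first: "convex_on feasible_set (\<lambda>lam :: real ^ 'k. \<Sum>k\<in>UNIV.
      48 * ((1 - (lam $ k)\<^sup>2) / (lam $ k)\<^sup>2) * \<eta>\<^sup>2 * B\<^sup>2 * (real Q)\<^sup>2 * L\<^sup>2)"
  proof (rule convex_on_sum_of_functions)
    fix k :: 'k
    have "convex_on feasible_set (\<lambda>lam :: real ^ 'k.
        (48 * \<eta>\<^sup>2 * B\<^sup>2 * (real Q)\<^sup>2 * L\<^sup>2) * ((1 - (lam $ k)\<^sup>2) / (lam $ k)\<^sup>2))"
      by (intro convex_on_cmul convex_on_coordinate convex_on_ratio_squares) simp
    then show "convex_on feasible_set (\<lambda>lam :: real ^ 'k.
        48 * ((1 - (lam $ k)\<^sup>2) / (lam $ k)\<^sup>2) * \<eta>\<^sup>2 * B\<^sup>2 * (real Q)\<^sup>2 * L\<^sup>2)"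
      by (simp add: mult_ac)
  qed (simp_all add: convex_feasible_set)
  have second: "convex_on feasible_set (\<lambda>lam :: real ^ 'k. MAX k\<in>UNIV.
      lam $ k * B\<^sup>2 * real Q * (4 * (1 - (lam $ k)\<^sup>2) / (lam $ k)\<^sup>2 + 1)
        / (P $ k * \<kappa> $ k * ln (1 / lam $ k)))"
  proof (rule convex_on_Max)
    fix k :: 'k
    \<comment> \<open>\<open>c\<close> collects the positive factors that do not depend on the
      variable, so that each entry of the maximum is \<open>c\<close> times the logarithmic
      quotient.\<close>
    define c where "c = B\<^sup>2 * real Q / (P $ k * \<kappa> $ k)"
    have "0 \<le> c"
      using assms by (simp add: c_def less_imp_le)
    have "convex_on {0<..<1} (\<lambda>x::real.
        x * B\<^sup>2 * real Q * (4 * (1 - x\<^sup>2) / x\<^sup>2 + 1) / (P $ k * \<kappa> $ k * ln (1 / x)))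
      \<longleftrightarrow> convex_on {0<..<1} (\<lambda>x. c * ((4 / x - 3 * x) / ln (1 / x)))"
    proof (rule convex_on_cong_on)
      fix x :: real
      assume "x \<in> {0<..<1}"
      \<comment> \<open>The bracket equals 4/x^2 - 3 for nonzero \<open>x\<close>; the outer factor
        \<open>x\<close> turns it into the numerator of the quotient.\<close>
      then have "x * (4 * (1 - x\<^sup>2) / x\<^sup>2 + 1) = 4 / x - 3 * x"
        by (simp add: field_simps eval_nat_numeral)
      then have "c * ((4 / x - 3 * x) / ln (1 / x))
          = B\<^sup>2 * real Q / (P $ k * \<kappa> $ k) * (x * (4 * (1 - x\<^sup>2) / x\<^sup>2 + 1) / ln (1 / x))"
        unfolding c_def by (simp only:)
      also have "\<dots> = x * B\<^sup>2 * real Q * (4 * (1 - x\<^sup>2) / x\<^sup>2 + 1) / (P $ k * \<kappa> $ k * ln (1 / x))"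
        by (simp only: times_divide_times_eq mult_ac)
      finally show "x * B\<^sup>2 * real Q * (4 * (1 - x\<^sup>2) / x\<^sup>2 + 1) / (P $ k * \<kappa> $ k * ln (1 / x))
          = c * ((4 / x - 3 * x) / ln (1 / x))" ..
    qed
    then show "convex_on feasible_set (\<lambda>lam :: real ^ 'k.
        lam $ k * B\<^sup>2 * real Q * (4 * (1 - (lam $ k)\<^sup>2) / (lam $ k)\<^sup>2 + 1)
          / (P $ k * \<kappa> $ k * ln (1 / lam $ k)))"
      using convex_on_cmul[OF \<open>0 \<le> c\<close> convex_on_log_quotient]
      by (intro convex_on_coordinate) blast
  qed simp_all
  \<comment> \<open>A nonnegative coefficient is what lets the maximum be scaled and added without
    losing convexity.\<close>
  have "0 \<le> 8 * \<eta> * L * \<sigma>\<^sup>2 / (real CARD('k))\<^sup>2"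
    using assms by simp
  then show ?thesis
    unfolding convex_minimization_def objective_def
    by (intro conjI convex_feasible_set convex_on_add convex_on_cmul first second) simp_all
qed

end
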